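(* Let $1\le k\le n$, let $H:\mathbb{R}^{2n}\to\mathbb{R}$ be smooth, let $A\in\mathbb{R}^{2n\times 2k}$ satisfy $A^TJ_{2n}A=J_{2k}$, and let $x_0\in\mathrm{Range}(A)$. Suppose there exists a bounded open set $S\subset\mathbb{R}^{2n}$ containing $x_0$ such that either $H(x_0)<H(x)$ for all $x\in\partial S$, or $H(x_0)>H(x)$ for all $x\in\partial S$. Then both the solution $x(t)$ of the original Hamiltonian system $\dot x=J_{2n}\nabla_xH(x)$, $x(0)=x_0$, and the solution $z(t)$ of the reduced system $\dot z=J_{2k}\nabla_z\tilde H(z)$, $z(0)=A^+x_0$, where $\tilde H(z)=H(Az)$, are bounded for all $t\in\mathbb{R}$.
   Context: For a positive integer $m$, $J_{2m}=\begin{bmatrix}0_m & I_m\\ -I_m & 0_m\end{bmatrix}$. For $A\in\mathbb{R}^{2n\times 2k}$, the symplectic inverse is $A^+:=J_{2k}^TA^TJ_{2n}\in\mathbb{R}^{2k\times 2n}$. The reduced system $\dot z=J_{2k}\nabla_z\tilde H(z)$, $z(0)=A^+x_0$, with $\tilde H=H\circ A$ and $A^TJ_{2n}A=J_{2k}$, is called the reduced system constructed by the symplectic projection. $\partial S$ denotes the topological boundary of $S$ in $\mathbb{R}^{2n}$. Solutions are understood as maximal solutions of the ODEs. *)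

theory Defs
  imports "HOL-Analysis.Analysis"
begin

(* R^{2m} is real ^ ('m + 'm) with m = CARD('m): the indices Inl i are the first m coordinates
   and the indices Inr i are the last m coordinates. *)

definition J_mat :: "real ^ ('m::finite + 'm) ^ ('m + 'm)" where
  "J_mat = (\<chi> i j. case (i, j) of
      (Inl a, Inr b) \<Rightarrow> (if a = b then 1 else 0)
    | (Inr a, Inl b) \<Rightarrow> (if a = b then - 1 else 0)
    | _ \<Rightarrow> 0)"

definition symplectic_inverse ::
  "real ^ ('k::finite + 'k) ^ ('n::finite + 'n) \<Rightarrow> real ^ ('n + 'n) ^ ('k + 'k)" where
  "symplectic_inverse A = transpose J_mat ** transpose A ** J_mat"

(* In finite dimension, f is of class C^(m+1) iff it is differentiable and all its directional
   derivatives are of class C^m. *)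
primrec of_class_C :: "nat \<Rightarrow> ('a::euclidean_space \<Rightarrow> real) \<Rightarrow> bool" where
  "of_class_C 0 f \<longleftrightarrow> continuous_on UNIV f"
| "of_class_C (Suc m) f \<longleftrightarrow>
     (\<forall>x. f differentiable (at x)) \<and>
     (\<forall>v. of_class_C m (\<lambda>x. frechet_derivative f (at x) v))"

definition smooth :: "('a::euclidean_space \<Rightarrow> real) \<Rightarrow> bool" where
  "smooth f \<longleftrightarrow> (\<forall>m. of_class_C m f)"

(* Meaningful where f is differentiable; the gradient is then unique. *)
definition grad :: "('a::euclidean_space \<Rightarrow> real) \<Rightarrow> 'a \<Rightarrow> 'a" where
  "grad f x = (THE D. GDERIV f x :> D)"

definition hamiltonian_field ::
  "(real ^ ('m::finite + 'm) \<Rightarrow> real) \<Rightarrow> real ^ ('m + 'm) \<Rightarrow> real ^ ('m + 'm)" where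
  "hamiltonian_field H x = J_mat *v grad H x"

definition solution_on ::
  "('a::euclidean_space \<Rightarrow> 'a) \<Rightarrow> 'a \<Rightarrow> real set \<Rightarrow> (real \<Rightarrow> 'a) \<Rightarrow> bool" where
  "solution_on f x0 I x \<longleftrightarrow>
     open I \<and> is_interval I \<and> 0 \<in> I \<and> x 0 = x0 \<and>
     (\<forall>t\<in>I. (x has_vector_derivative f (x t)) (at t))"

(* The values of x outside I are irrelevant. *)
definition maximal_solution ::
  "('a::euclidean_space \<Rightarrow> 'a) \<Rightarrow> 'a \<Rightarrow> real set \<Rightarrow> (real \<Rightarrow> 'a) \<Rightarrow> bool" where
  "maximal_solution f x0 I x \<longleftrightarrow>
     solution_on f x0 I x \<and>
     (\<forall>I' x'. solution_on f x0 I' x' \<and> I \<subseteq> I' \<and> (\<forall>t\<in>I. x' t = x t) \<longrightarrow> I' = I)"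

end

theory Submission
  imports Defs
begin

text \<open>The Hamiltonian is conserved along solutions because J is skew-symmetric. A solution starting in S
  and leaving it would meet the frontier of S at a point where H takes the value H(x0), which the
  hypothesis excludes; so every solution stays in the bounded set S. There the vector field agrees
  with a globally Lipschitz one, the field precomposed with the projection onto a large ball, so
  solutions exist for all times and are unique. The reduced system is again Hamiltonian, now on the
  preimage of S under A: this is bounded since A has the left inverse \<open>A\<^sup>+\<close>, its frontier is mapped
  into that of S, and \<open>A A\<^sup>+ x0 = x0\<close> since x0 lies in the range of A.\<close>

section \<open>Global solutions for Lipschitz fields\<close>

lemma antiderivative_exists:
  fixes f :: "real \<Rightarrow> 'a::banach"
  assumes "continuous_on UNIV f"
  shows "\<exists>P. P 0 = 0 \<and> (\<forall>t. (P has_vector_derivative f t) (at t))"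
proof -
  \<comment> \<open>For either sign of \<open>t\<close> one of the two intervals is empty or a
    point, so its integral vanishes. The difference is thus the oriented integral from 0 to
    \<open>t\<close>.\<close>
  let ?P = "\<lambda>t. integral {0..t} f - integral {t..0} f"
  have "(?P has_vector_derivative f t) (at t)" for t :: real
  proof -
    \<comment> \<open>The open interval from \<open>a\<close> to \<open>b\<close> contains both 0
      and \<open>t\<close>. On it the oriented integral differs only by a constant from the integral
      with fixed left end \<open>a\<close>, whose derivative is known.\<close>
    define a b where "a = - (\<bar>t\<bar> + 1)" and "b = \<bar>t\<bar> + 1"
    have ab: "a < 0" "0 < b" "a < t" "t < b" by (auto simp: a_def b_def)
    have cont: "continuous_on {u..v} f" for u v
      by (rule continuous_on_subset[OF assms]) simp
    have int: "f integrable_on {u..v}" for u v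
      by (rule integrable_continuous_real[OF cont])
    have "((\<lambda>u. integral {a..u} f) has_vector_derivative f t) (at t within {a..b})"
      by (rule integral_has_vector_derivative[OF cont]) (use ab in auto)
    then have "((\<lambda>u. integral {a..u} f) has_vector_derivative f t) (at t)"
      using at_within_Icc_at[OF ab(3,4)] by simp
    then have *: "((\<lambda>u. integral {a..u} f - integral {a..0} f) has_vector_derivative f t) (at t)"
      by (rule has_vector_derivative_eq_rhs[OF has_vector_derivative_diff[OF _ has_vector_derivative_const]]) simp
    have eq: "integral {a..u} f - integral {a..0} f = ?P u" if "u \<in> {a<..<b}" for u
    proof (cases "0 \<le> u")
      case True
      have "integral {u..0} f = 0" using True by (cases "u = 0") auto
      moreover have "integral {a..0} f + integral {0..u} f = integral {a..u} f"
        using True ab by (intro Henstock_Kurzweil_Integration.integral_combine int) auto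
      ultimately show ?thesis by (metis add_diff_cancel_left' diff_zero)
    next
      case False
      then have "integral {0..u} f = 0" by simp
      moreover have "integral {a..u} f + integral {u..0} f = integral {a..0} f"
        using False that by (intro Henstock_Kurzweil_Integration.integral_combine int) auto
      ultimately show ?thesis by (metis add_diff_cancel_left' diff_0 minus_diff_eq)
    qed
    show "(?P has_vector_derivative f t) (at t)"
      by (rule has_vector_derivative_transform_within_open[OF * open_greaterThanLessThan _ eq])
         (use ab in auto)
  qed
  then show ?thesis by (intro exI[of _ ?P]) simp
qed

text \<open>Integrating the bound \<open>K * exp (c * s)\<close> from 0 to \<open>t\<close> gives
  \<open>K / c * (exp (c * t) - 1)\<close>. The gain of the factor \<open>1 / c\<close> is what
  makes the Picard map below a contraction.\<close>

lemma exponential_growth_bound_nonneg: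
  fixes P :: "real \<Rightarrow> 'a::real_normed_vector"
  assumes "P 0 = 0" and P: "\<And>t. (P has_vector_derivative p t) (at t)"
    and p: "\<And>s. norm (p s) \<le> K * exp (c * \<bar>s\<bar>)" and "c > 0" and "t \<ge> 0"
  shows "norm (P t) \<le> K / c * exp (c * \<bar>t\<bar>)"
proof -
  have K: "K \<ge> 0" using order_trans[OF norm_ge_zero p[of 0]] by simp
  show ?thesis
  proof (cases "t = 0")
    case True
    then show ?thesis using assms K by simp
  next
    case False
    have "norm (P t - P 0) \<le> K / c * exp (c * t) - K / c * exp (c * 0)"
    proof (rule differentiable_bound_general[where f' = p and \<phi>' = "\<lambda>s. K * exp (c * s)"])
      show "0 < t" using False assms by simp
      show "continuous_on {0..t} P"
        using P by (meson continuous_at_imp_continuous_on has_vector_derivative_continuous)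
      show "continuous_on {0..t} (\<lambda>s. K / c * exp (c * s))" by (intro continuous_intros)
      fix s assume s: "0 < s" "s < t"
      show "(P has_vector_derivative p s) (at s)" by (rule P)
      show "((\<lambda>s. K / c * exp (c * s)) has_vector_derivative K * exp (c * s)) (at s)"
        unfolding has_real_derivative_iff_has_vector_derivative[symmetric]
        using \<open>c > 0\<close> by (auto intro!: derivative_eq_intros)
      show "norm (p s) \<le> K * exp (c * s)" using p[of s] s by simp
    qed
    moreover have "K / c \<ge> 0" using K \<open>c > 0\<close> by simp
    ultimately show ?thesis using assms by simp
  qed
qed

lemma has_vector_derivative_reflect:
  assumes "(f has_vector_derivative f') (at (- t))"
  shows "((\<lambda>t. f (- t)) has_vector_derivative - f') (at t)"
proof -
  have "(uminus has_vector_derivative (- 1 :: real)) (at t)"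
    using has_vector_derivative_minus[OF has_vector_derivative_id[of "at t"]] by (simp add: id_def)
  from vector_diff_chain_at[OF this assms] show ?thesis
    by (simp add: o_def)
qed

lemma exponential_growth_bound:
  fixes P :: "real \<Rightarrow> 'a::real_normed_vector"
  assumes "P 0 = 0" and P: "\<And>t. (P has_vector_derivative p t) (at t)"
    and p: "\<And>s. norm (p s) \<le> K * exp (c * \<bar>s\<bar>)" and "c > 0"
  shows "norm (P t) \<le> K / c * exp (c * \<bar>t\<bar>)"
proof (cases "t \<ge> 0")
  case True
  then show ?thesis using exponential_growth_bound_nonneg[OF assms] by simp
next
  case False
  have d: "((\<lambda>t. P (- t)) has_vector_derivative - p (- s)) (at s)" for s
    by (rule has_vector_derivative_reflect[OF P])
  have b: "norm (- p (- s)) \<le> K * exp (c * \<bar>s\<bar>)" for s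
    using p[of "- s"] by simp
  have "norm (P (- (- t))) \<le> K / c * exp (c * \<bar>- t\<bar>)"
    by (rule exponential_growth_bound_nonneg[OF _ d b \<open>c > 0\<close>]) (use \<open>P 0 = 0\<close> False in simp_all)
  then show ?thesis by simp
qed

text \<open>Picard iteration is a contraction on all of time at once when the curve is written as
  \<open>x t = x0 + exp (c * \<bar>t\<bar>) *\<^sub>R u t\<close> with \<open>u\<close> bounded and \<open>c\<close> larger than the Lipschitz constant.\<close>

lemma global_solution_exists:
  fixes G :: "'a::euclidean_space \<Rightarrow> 'a"
  assumes G: "L-lipschitz_on UNIV G"
  shows "\<exists>x. solution_on G x0 UNIV x"
proof -
  \<comment> \<open>Adding 1 makes \<open>c\<close> positive even for \<open>L = 0\<close> and gives
    the contraction factor \<open>L / c < 1\<close>.\<close>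
  define c where "c = L + 1"
  have L: "L \<ge> 0" using G by (rule lipschitz_on_nonneg)
  then have c: "c > 0" "L / c < 1" "0 \<le> L / c" by (auto simp: c_def)
  have contG: "continuous_on UNIV G" using G by (rule lipschitz_on_continuous_on)
  define x where "x u t = x0 + exp (c * \<bar>t\<bar>) *\<^sub>R apply_bcontfun u t" for u :: "real \<Rightarrow>\<^sub>C 'a" and t
  have "continuous_on UNIV (\<lambda>t. G (x u t))" for u
    unfolding x_def by (intro continuous_intros continuous_on_compose2[OF contG]) auto
  then have "\<forall>u. \<exists>P. P 0 = 0 \<and> (\<forall>t. (P has_vector_derivative G (x u t)) (at t))"
    using antiderivative_exists by blast
  then obtain P where P0: "\<And>u. P u 0 = 0"
    and P: "\<And>u t. (P u has_vector_derivative G (x u t)) (at t)"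
    by metis
  have contP: "continuous_on UNIV (P u)" for u
    using P by (meson continuous_at_imp_continuous_on has_vector_derivative_continuous)
  \<comment> \<open>This growth estimate keeps the Picard map inside the bounded functions: after
    division by the weight \<open>exp (c * \<bar>t\<bar>)\<close>, the curve \<open>P u\<close> is
    bounded.\<close>
  have "norm (P u t) \<le> (norm (G x0) + L * norm u) / c * exp (c * \<bar>t\<bar>)" for u t
  proof (rule exponential_growth_bound[OF P0 P _ c(1)])
    fix s
    have "norm (G (x u s) - G x0) \<le> L * (exp (c * \<bar>s\<bar>) * norm (apply_bcontfun u s))"
      using lipschitz_on_normD[OF G, of "x u s" x0] by (simp add: x_def)
    also have "\<dots> \<le> L * (exp (c * \<bar>s\<bar>) * norm u)"
      using L by (intro mult_left_mono norm_bounded) auto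
    finally have "norm (G (x u s)) \<le> norm (G x0) * 1 + L * (exp (c * \<bar>s\<bar>) * norm u)"
      using norm_triangle_sub[of "G (x u s)" "G x0"] by simp
    also have "\<dots> \<le> norm (G x0) * exp (c * \<bar>s\<bar>) + L * (exp (c * \<bar>s\<bar>) * norm u)"
      using c by (intro add_right_mono mult_left_mono) auto
    finally show "norm (G (x u s)) \<le> (norm (G x0) + L * norm u) * exp (c * \<bar>s\<bar>)"
      by (simp add: algebra_simps)
  qed
  then have "norm (exp (- (c * \<bar>t\<bar>)) *\<^sub>R P u t) \<le> (norm (G x0) + L * norm u) / c" for u t
    by (simp add: exp_minus field_simps)
  then have bc: "(\<lambda>t. exp (- (c * \<bar>t\<bar>)) *\<^sub>R P u t) \<in> bcontfun" for u
    by (intro bcontfun_normI continuous_intros contP)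
  \<comment> \<open>The Picard iterate of the curve \<open>x u\<close> is \<open>x0 + P u\<close>;
    \<open>\<Phi> u\<close> is its representative in the weighted form.\<close>
  define \<Phi> where "\<Phi> u = Bcontfun (\<lambda>t. exp (- (c * \<bar>t\<bar>)) *\<^sub>R P u t)" for u
  have \<Phi>: "apply_bcontfun (\<Phi> u) t = exp (- (c * \<bar>t\<bar>)) *\<^sub>R P u t" for u t
    using bc by (simp add: \<Phi>_def Bcontfun_inverse)
  \<comment> \<open>The difference of two curves carries the weight
    \<open>exp (c * \<bar>s\<bar>)\<close>, the Lipschitz bound contributes \<open>L\<close> and the
    integration \<open>1 / c\<close>. The resulting factor does not depend on the length of the time
    interval.\<close>
  have "dist (\<Phi> u) (\<Phi> v) \<le> L / c * dist u v" for u v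
  proof (rule dist_bound)
    fix t
    have "norm (P u t - P v t) \<le> (L * dist u v) / c * exp (c * \<bar>t\<bar>)"
    proof (rule exponential_growth_bound[where P = "\<lambda>t. P u t - P v t", OF _ _ _ c(1)])
      show "P u 0 - P v 0 = 0" by (simp add: P0)
      fix s
      show "((\<lambda>t. P u t - P v t) has_vector_derivative G (x u s) - G (x v s)) (at s)"
        by (intro has_vector_derivative_diff P)
      have "x u s - x v s = exp (c * \<bar>s\<bar>) *\<^sub>R (apply_bcontfun u s - apply_bcontfun v s)"
        by (simp add: x_def algebra_simps)
      then have "norm (G (x u s) - G (x v s))
          \<le> L * (exp (c * \<bar>s\<bar>) * dist (apply_bcontfun u s) (apply_bcontfun v s))"
        using lipschitz_on_normD[OF G, of "x u s" "x v s"] by (simp add: dist_norm)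
      also have "\<dots> \<le> L * (exp (c * \<bar>s\<bar>) * dist u v)"
        using L by (intro mult_left_mono dist_bounded) auto
      finally show "norm (G (x u s) - G (x v s)) \<le> (L * dist u v) * exp (c * \<bar>s\<bar>)"
        by (simp add: algebra_simps)
    qed
    then have "exp (- (c * \<bar>t\<bar>)) * norm (P u t - P v t) \<le> L / c * dist u v"
      by (simp add: exp_minus field_simps)
    then show "dist (apply_bcontfun (\<Phi> u) t) (apply_bcontfun (\<Phi> v) t) \<le> L / c * dist u v"
      by (simp add: \<Phi> dist_norm scaleR_diff_right[symmetric])
  qed
  then obtain u where u: "\<Phi> u = u"
    using banach_fix_type[OF c(3,2)] by blast
  \<comment> \<open>A fixed point satisfies the integral equation, and differentiating it gives the
    differential equation.\<close>
  have "x u = (\<lambda>t. x0 + P u t)"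
  proof
    fix t
    have "apply_bcontfun u t = exp (- (c * \<bar>t\<bar>)) *\<^sub>R P u t" using \<Phi>[of u t] u by simp
    then show "x u t = x0 + P u t" by (simp add: x_def exp_minus)
  qed
  moreover have "((\<lambda>t. x0 + P u t) has_vector_derivative G (x u t)) (at t)" for t
    using P by (auto intro!: derivative_eq_intros)
  ultimately have "solution_on G x0 UNIV (x u)"
    by (simp add: solution_on_def P0)
  then show ?thesis by blast
qed

section \<open>Time reversal, restriction and change of the field of a solution\<close>

lemma solution_on_reverse:
  assumes "solution_on F x0 I x"
  shows "solution_on (\<lambda>v. - F v) x0 (uminus ` I) (\<lambda>t. x (- t))"
proof -
  have mem: "t \<in> uminus ` I \<longleftrightarrow> - t \<in> I" for t :: real by force
  have "((\<lambda>t. x (- t)) has_vector_derivative - F (x (- t))) (at t)" if "t \<in> uminus ` I" for t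
    using assms that by (intro has_vector_derivative_reflect) (auto simp: solution_on_def mem)
  moreover have "open (uminus ` I)" using assms by (simp add: solution_on_def open_negations)
  moreover have "is_interval (uminus ` I)"
    unfolding is_interval_1
  proof (intro ballI allI impI, unfold mem)
    fix a b t assume "- a \<in> I" "- b \<in> I" and "a \<le> t \<and> t \<le> b"
    moreover from this have "- b \<le> - t \<and> - t \<le> - a" by simp
    ultimately show "- t \<in> I"
      using assms unfolding solution_on_def is_interval_1 by blast
  qed
  ultimately show ?thesis using assms by (auto simp: solution_on_def mem)
qed

lemma solution_on_subset:
  assumes "solution_on F x0 I x" "J \<subseteq> I" "open J" "is_interval J" "0 \<in> J"
  shows "solution_on F x0 J x"
  using assms unfolding solution_on_def by blast

lemma solution_on_cong_field:
  assumes "solution_on F x0 I x" "\<And>t. t \<in> I \<Longrightarrow> G (x t) = F (x t)"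
  shows "solution_on G x0 I x"
  using assms unfolding solution_on_def by auto

section \<open>Confinement by a conserved quantity\<close>

text \<open>At a first exit time the curve would be on the frontier while \<open>V\<close> still has
  its initial value. The assumptions on \<open>V'\<close> and \<open>F\<close> are confined to
  \<open>closure S\<close> so that the lemma also applies to a field modified away from that
  set.\<close>

lemma conserved_confines_nonneg:
  fixes F :: "'a::euclidean_space \<Rightarrow> 'a" and V :: "'a \<Rightarrow> real"
  assumes sol: "solution_on F x0 I x"
    and V: "\<And>v. v \<in> closure S \<Longrightarrow> (V has_derivative V' v) (at v)"
    and cons: "\<And>v. v \<in> closure S \<Longrightarrow> V' v (F v) = 0"
    and S: "open S" "x0 \<in> S" and fr: "\<And>v. v \<in> frontier S \<Longrightarrow> V v \<noteq> V x0"
    and t: "t \<in> I" "t \<ge> 0"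
  shows "x t \<in> S"
proof (rule ccontr)
  assume out: "x t \<notin> S"
  have I: "s \<in> I" if "0 \<le> s" "s \<le> t" for s
    using mem_is_interval_1_I[of I 0 t s] sol t that by (simp add: solution_on_def)
  have dx: "(x has_vector_derivative F (x s)) (at s)" if "0 \<le> s" "s \<le> t" for s
    using sol I[OF that] unfolding solution_on_def by blast
  then have cx: "continuous_on {0..t} x"
    by (meson atLeastAtMost_iff continuous_at_imp_continuous_on has_vector_derivative_continuous)
  \<comment> \<open>The set of times spent outside \<open>S\<close> is closed because
    \<open>S\<close> is open, so its infimum \<open>b\<close> belongs to it and is the first exit
    time.\<close>
  define B where "B = {s \<in> {0..t}. x s \<in> - S}"
  have "closed B"
    unfolding B_def using continuous_closed_preimage[OF cx, of "- S"] S(1)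
    by (simp add: vimage_def Int_def closed_Compl conj_assoc)
  moreover have "B \<noteq> {}" "bdd_below B" using out t by (auto simp: B_def)
  ultimately have inB: "Inf B \<in> B" using closed_contains_Inf by blast
  define b where "b = Inf B"
  have b: "0 \<le> b" "b \<le> t" "x b \<notin> S" using inB by (auto simp: B_def b_def)
  have before: "x s \<in> S" if "0 \<le> s" "s < b" for s
  proof (rule ccontr)
    assume "x s \<notin> S"
    then have "s \<in> B" using that b by (auto simp: B_def)
    then have "b \<le> s" unfolding b_def using \<open>bdd_below B\<close> by (rule cInf_lower)
    then show False using that by simp
  qed
  have "x 0 = x0" using sol by (simp add: solution_on_def)
  then have "b \<noteq> 0" using b S by auto
  then have b0: "0 < b" using b by simp
  \<comment> \<open>The exit point is a limit of points visited before time \<open>b\<close>, all of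
    which lie in \<open>S\<close>.\<close>
  have "x b \<in> closure S"
  proof -
    have "x ` closure {0..<b} \<subseteq> closure S"
    proof (rule image_closure_subset)
      show "continuous_on (closure {0..<b}) x"
        using cx by (rule continuous_on_subset) (use b0 b in auto)
      show "x ` {0..<b} \<subseteq> closure S" using before closure_subset by fastforce
    qed simp
    then show ?thesis using b0 by auto
  qed
  then have cl: "x s \<in> closure S" if "0 \<le> s" "s \<le> b" for s
    using before[of s] closure_subset that by (cases "s = b") auto
  have dV: "((\<lambda>s. V (x s)) has_real_derivative 0) (at s)" if "0 \<le> s" "s \<le> b" for s
  proof -
    have "((V \<circ> x) has_vector_derivative V' (x s) (F (x s))) (at s)"
      using vector_derivative_diff_chain_within[OF dx has_derivative_at_withinI[OF V[OF cl]]] that b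
      by auto
    then show ?thesis
      using cons[OF cl[OF that]]
      by (simp add: o_def has_real_derivative_iff_has_vector_derivative)
  qed
  have "V (x b) = V (x 0)"
  proof (rule DERIV_isconst_end[OF b0])
    show "continuous_on {0..b} (\<lambda>s. V (x s))"
      using dV by (meson DERIV_isCont atLeastAtMost_iff continuous_at_imp_continuous_on)
  qed (use dV in auto)
  moreover have "x b \<in> frontier S"
    using \<open>x b \<in> closure S\<close> b S by (simp add: frontier_def interior_open)
  ultimately show False using fr \<open>x 0 = x0\<close> by auto
qed

lemma conserved_confines:
  fixes F :: "'a::euclidean_space \<Rightarrow> 'a" and V :: "'a \<Rightarrow> real"
  assumes sol: "solution_on F x0 I x"
    and V: "\<And>v. v \<in> closure S \<Longrightarrow> (V has_derivative V' v) (at v)"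
    and cons: "\<And>v. v \<in> closure S \<Longrightarrow> V' v (F v) = 0"
    and S: "open S" "x0 \<in> S" and fr: "\<And>v. v \<in> frontier S \<Longrightarrow> V v \<noteq> V x0"
    and t: "t \<in> I"
  shows "x t \<in> S"
proof (cases "t \<ge> 0")
  case True
  then show ?thesis using conserved_confines_nonneg[OF sol V cons S fr t] by blast
next
  case False
  \<comment> \<open>Negative times are reached by reversing time, which negates the field; by
    linearity \<open>V'\<close> annihilates the negated field too.\<close>
  have "V' v (- F v) = 0" if "v \<in> closure S" for v
    using linear_neg[OF has_derivative_linear[OF V[OF that]], of "F v"] cons[OF that] by simp
  then have "x (- (- t)) \<in> S"
    using conserved_confines_nonneg[OF solution_on_reverse[OF sol] V _ S fr, of "- t"] t False
    by auto
  then show ?thesis by simp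
qed

section \<open>Uniqueness of solutions confined to a set on which the field is Lipschitz\<close>

lemma lipschitz_solutions_agree_nonneg:
  fixes F :: "'a::euclidean_space \<Rightarrow> 'a"
  assumes x: "solution_on F x0 I x" and y: "solution_on F x0 I y"
    and L: "L-lipschitz_on S F"
    and xS: "\<And>t. t \<in> I \<Longrightarrow> x t \<in> S" and yS: "\<And>t. t \<in> I \<Longrightarrow> y t \<in> S"
    and t: "t \<in> I" "t \<ge> 0"
  shows "x t = y t"
proof -
  have I: "s \<in> I" if "0 \<le> s" "s \<le> t" for s
    using mem_is_interval_1_I[of I 0 t s] x t that by (simp add: solution_on_def)
  define d where "d s = x s - y s" for s
  \<comment> \<open>Gronwall argument: the squared distance grows at rate at most
    \<open>2 * L\<close>, by Cauchy-Schwarz and the Lipschitz bound, so the weight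
    \<open>exp (- (2 * L * s))\<close> makes it nonincreasing. It starts at 0.\<close>
  have "(d t \<bullet> d t) * exp (- (2 * L * t)) \<le> (d 0 \<bullet> d 0) * exp (- (2 * L * 0))"
  proof (rule DERIV_nonpos_imp_nonincreasing[OF t(2), where f = "\<lambda>s. (d s \<bullet> d s) * exp (- (2 * L * s))"])
    fix s assume s: "0 \<le> s" "s \<le> t"
    let ?e = "F (x s) - F (y s)"
    have "(x has_vector_derivative F (x s)) (at s)" "(y has_vector_derivative F (y s)) (at s)"
      using x y I[OF s] unfolding solution_on_def by blast+
    then have "(d has_vector_derivative ?e) (at s)"
      unfolding d_def by (rule has_vector_derivative_diff)
    then have "((\<lambda>s. d s \<bullet> d s) has_vector_derivative (d s \<bullet> ?e + ?e \<bullet> d s)) (at s)"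
      by (intro bounded_bilinear.has_vector_derivative[OF bounded_bilinear_inner])
    then have "((\<lambda>s. d s \<bullet> d s) has_real_derivative 2 * (d s \<bullet> ?e)) (at s)"
      by (simp add: has_real_derivative_iff_has_vector_derivative inner_commute)
    then have "((\<lambda>s. (d s \<bullet> d s) * exp (- (2 * L * s))) has_real_derivative
        2 * (d s \<bullet> ?e - L * (d s \<bullet> d s)) * exp (- (2 * L * s))) (at s)"
      by (auto intro!: derivative_eq_intros simp: algebra_simps)
    moreover have "d s \<bullet> ?e \<le> L * (d s \<bullet> d s)"
    proof -
      have "d s \<bullet> ?e \<le> norm (d s) * norm ?e" by (rule norm_cauchy_schwarz)
      also have "\<dots> \<le> norm (d s) * (L * norm (d s))"
        unfolding d_def using lipschitz_on_normD[OF L xS yS] I[OF s]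
        by (intro mult_left_mono) auto
      also have "\<dots> = L * (d s \<bullet> d s)" by (simp add: dot_square_norm power2_eq_square)
      finally show ?thesis .
    qed
    ultimately show "\<exists>D. ((\<lambda>s. (d s \<bullet> d s) * exp (- (2 * L * s))) has_real_derivative D) (at s) \<and> D \<le> 0"
      by (intro exI conjI) (auto intro!: mult_nonpos_nonneg)
  qed
  moreover have "d 0 = 0" using x y by (simp add: solution_on_def d_def)
  ultimately have "d t \<bullet> d t = 0"
    by (intro antisym inner_ge_zero) (simp add: mult_le_0_iff)
  then show ?thesis by (simp add: d_def)
qed

lemma lipschitz_solutions_agree:
  fixes F :: "'a::euclidean_space \<Rightarrow> 'a"
  assumes x: "solution_on F x0 I x" and y: "solution_on F x0 I y"
    and L: "L-lipschitz_on S F"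
    and xS: "\<And>t. t \<in> I \<Longrightarrow> x t \<in> S" and yS: "\<And>t. t \<in> I \<Longrightarrow> y t \<in> S"
    and t: "t \<in> I"
  shows "x t = y t"
proof (cases "t \<ge> 0")
  case True
  then show ?thesis using lipschitz_solutions_agree_nonneg[OF assms] by blast
next
  case False
  have "x (- (- t)) = y (- (- t))"
    by (rule lipschitz_solutions_agree_nonneg[OF solution_on_reverse[OF x] solution_on_reverse[OF y]
          lipschitz_on_minus[OF L]])
       (use xS yS t False in auto)
  then show ?thesis by simp
qed

lemma conserved_quantity_maximal_solution:
  fixes F :: "'a::euclidean_space \<Rightarrow> 'a" and V :: "'a \<Rightarrow> real"
  assumes V: "\<And>v. (V has_derivative V' v) (at v)"
    and cons: "\<And>v. V' v (F v) = 0"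
    and lip: "\<And>R. \<exists>L. L-lipschitz_on (cball 0 R) F"
    and S: "open S" "bounded S" "x0 \<in> S"
    and fr: "\<And>v. v \<in> frontier S \<Longrightarrow> V v \<noteq> V x0"
  shows "\<exists>x. maximal_solution F x0 UNIV x \<and> bounded (range x) \<and>
            (\<forall>I y. maximal_solution F x0 I y \<longrightarrow> I = UNIV \<and> y = x)"
proof -
  obtain R where "S \<subseteq> cball 0 R"
    using S(2) by (metis bounded_iff mem_cball_0 subsetI)
  then have SR: "closure S \<subseteq> cball 0 R" by (simp add: closure_minimal)
  have ne: "cball (0::'a) R \<noteq> {}" using SR S closure_subset by blast
  obtain L where L: "L-lipschitz_on (cball 0 R) F" using lip by blast
  \<comment> \<open>Projection onto a closed ball is 1-Lipschitz, so \<open>G\<close> is globally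
    Lipschitz with the constant of \<open>F\<close> on the ball, and it equals \<open>F\<close> on
    \<open>closure S\<close>.\<close>
  define G where "G v = F (closest_point (cball 0 R) v)" for v
  have GF: "G v = F v" if "v \<in> closure S" for v
    using that SR by (simp add: G_def closest_point_self subset_iff)
  have "L-lipschitz_on UNIV G"
  proof (rule lipschitz_onI)
    show "0 \<le> L" using L by (rule lipschitz_on_nonneg)
    fix u v :: 'a
    have "dist (G u) (G v) \<le> L * dist (closest_point (cball 0 R) u) (closest_point (cball 0 R) v)"
      unfolding G_def by (intro lipschitz_onD[OF L] closest_point_in_set ne) auto
    also have "\<dots> \<le> L * dist u v"
      using \<open>0 \<le> L\<close> by (intro mult_left_mono closest_point_lipschitz ne) auto
    finally show "dist (G u) (G v) \<le> L * dist u v" .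
  qed
  then obtain x where xG: "solution_on G x0 UNIV x"
    using global_solution_exists by blast
  \<comment> \<open>\<open>V\<close> is conserved by \<open>G\<close> on \<open>closure S\<close>,
    where \<open>G\<close> agrees with \<open>F\<close>. Hence the global solution of the modified
    system never leaves \<open>S\<close> and also solves the original one.\<close>
  have xS: "x t \<in> S" for t
    using conserved_confines[OF xG V _ S(1,3) fr, of t] GF cons by auto
  have "F (x t) = G (x t)" for t
    using GF[of "x t"] xS[of t] closure_subset[of S] by auto
  then have xF: "solution_on F x0 UNIV x"
    by (rule solution_on_cong_field[OF xG])
  have max: "maximal_solution F x0 UNIV x"
    using xF by (auto simp: maximal_solution_def)
  have "I = UNIV \<and> y = x" if "maximal_solution F x0 I y" for I y
  proof -
    have y: "solution_on F x0 I y" using that by (simp add: maximal_solution_def)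
    have yS: "y t \<in> S" if "t \<in> I" for t
      using conserved_confines[OF y V cons S(1,3) fr that] .
    have "solution_on F x0 I x"
      by (rule solution_on_subset[OF xF]) (use y in \<open>auto simp: solution_on_def\<close>)
    moreover have "L-lipschitz_on S F"
      using L by (rule lipschitz_on_subset) (use SR closure_subset in blast)
    ultimately have eq: "x t = y t" if "t \<in> I" for t
      using lipschitz_solutions_agree[where x = x, OF _ y _ xS yS that] by blast
    \<comment> \<open>The global solution \<open>x\<close> extends \<open>y\<close>, so maximality
      of \<open>y\<close> leaves no smaller domain.\<close>
    then have "I = UNIV"
      using that xF unfolding maximal_solution_def by (metis subset_UNIV)
    then show ?thesis using eq by auto
  qed
  moreover have "bounded (range x)"
    using S(2) by (rule bounded_subset) (use xS in auto)
  ultimately show ?thesis using max by blast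
qed

section \<open>Gradients of smooth functions\<close>

lemma grad_eqI:
  assumes "GDERIV f x :> D"
  shows "grad f x = D"
  unfolding grad_def
proof (rule the_equality[of "\<lambda>D. GDERIV f x :> D", OF assms])
  fix E assume "GDERIV f x :> E"
  then have "(\<lambda>h. h \<bullet> E) = (\<lambda>h. h \<bullet> D)"
    using assms unfolding gderiv_def by (rule has_derivative_unique)
  then show "E = D" by (metis vector_eq_ldot)
qed

text \<open>Linearity of the derivative expresses the gradient through directional derivatives along
  the basis, and these are what \<open>of_class_C\<close> controls.\<close>

lemma
  assumes "f differentiable (at x)"
  shows GDERIV_grad: "GDERIV f x :> grad f x"
    and grad_eq_sum: "grad f x = (\<Sum>b\<in>Basis. frechet_derivative f (at x) b *\<^sub>R b)"
proof -
  let ?D = "\<Sum>b\<in>Basis. frechet_derivative f (at x) b *\<^sub>R b"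
  have f: "(f has_derivative frechet_derivative f (at x)) (at x)"
    using assms frechet_derivative_works by blast
  have "frechet_derivative f (at x) h = h \<bullet> ?D" for h
  proof -
    have "frechet_derivative f (at x) h
        = frechet_derivative f (at x) (\<Sum>b\<in>Basis. (h \<bullet> b) *\<^sub>R b)"
      by (simp add: euclidean_representation)
    also have "\<dots> = h \<bullet> ?D"
      by (simp add: linear_sum[OF has_derivative_linear[OF f]]
          linear_cmul[OF has_derivative_linear[OF f]] inner_sum_right mult.commute)
    finally show ?thesis .
  qed
  then have "frechet_derivative f (at x) = (\<lambda>h. h \<bullet> ?D)" by (rule ext)
  with f have D: "GDERIV f x :> ?D" by (simp only: gderiv_def)
  then show "grad f x = ?D" by (rule grad_eqI)
  with D show "GDERIV f x :> grad f x" by simp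
qed

text \<open>The partial derivatives are continuous, hence bounded on the compact ball. They bound
  the operator norm of the derivative, and the mean value inequality applies because the ball is
  convex.\<close>

lemma of_class_C_1_lipschitz_on_cball:
  fixes g :: "'a::euclidean_space \<Rightarrow> real"
  assumes "of_class_C 1 g"
  shows "\<exists>L. L-lipschitz_on (cball 0 R) g"
proof -
  let ?D = "\<lambda>x. frechet_derivative g (at x)"
  have g: "(g has_derivative ?D x) (at x)" for x
    unfolding frechet_derivative_works[symmetric] using assms by simp
  have "\<exists>M. \<forall>x\<in>cball 0 R. norm (?D x b) \<le> M" for b
  proof -
    have "continuous_on (cball 0 R) (\<lambda>x. ?D x b)"
      using assms by (auto intro: continuous_on_subset)
    then have "bounded ((\<lambda>x. ?D x b) ` cball 0 R)"
      by (intro compact_imp_bounded compact_continuous_image) auto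
    then show ?thesis by (simp add: bounded_iff)
  qed
  then have "\<exists>M. \<forall>b. \<forall>x\<in>cball 0 R. norm (?D x b) \<le> M b"
    by (intro choice allI)
  then obtain M where M: "\<And>b x. x \<in> cball 0 R \<Longrightarrow> norm (?D x b) \<le> M b"
    by blast
  \<comment> \<open>The absolute values make \<open>L\<close> nonnegative even for
    \<open>R < 0\<close>, where the ball is empty and \<open>M\<close> is unconstrained.\<close>
  define L where "L = (\<Sum>b\<in>(Basis::'a set). \<bar>M b\<bar>)"
  have on: "onorm (?D x) \<le> L" if "x \<in> cball 0 R" for x
  proof -
    have "onorm (?D x) \<le> (\<Sum>b\<in>Basis. norm (?D x b))"
      using g by (intro onorm_componentwise) (rule has_derivative_bounded_linear)
    also have "\<dots> \<le> L"
      unfolding L_def using M[OF that] by (intro sum_mono) (meson abs_ge_self order_trans)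
    finally show ?thesis .
  qed
  have "L-lipschitz_on (cball 0 R) g"
  proof (rule lipschitz_onI)
    show "0 \<le> L" by (simp add: L_def sum_nonneg)
    show "dist (g x) (g y) \<le> L * dist x y" if "x \<in> cball 0 R" "y \<in> cball 0 R" for x y
      unfolding dist_norm
      by (rule differentiable_bound[OF convex_cball has_derivative_at_withinI[OF g] on that])
  qed
  then show ?thesis ..
qed

lemma lipschitz_on_sum_exists:
  fixes f :: "'i \<Rightarrow> 'a::metric_space \<Rightarrow> 'b::real_normed_vector"
  assumes "finite B" "\<And>i. i \<in> B \<Longrightarrow> \<exists>L. L-lipschitz_on U (f i)"
  shows "\<exists>L. L-lipschitz_on U (\<lambda>x. \<Sum>i\<in>B. f i x)"
  using assms
proof (induction B)
  case empty
  have "0-lipschitz_on U (\<lambda>x. \<Sum>i\<in>{}. f i x)" by (simp add: lipschitz_on_constant)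
  then show ?case ..
next
  case (insert i B)
  then obtain L M where "L-lipschitz_on U (f i)" "M-lipschitz_on U (\<lambda>x. \<Sum>i\<in>B. f i x)"
    using insert.IH insert.prems by (meson insertI1 insertI2)
  then have "(L + M)-lipschitz_on U (\<lambda>x. f i x + (\<Sum>i\<in>B. f i x))"
    by (rule lipschitz_on_add)
  then have "(L + M)-lipschitz_on U (\<lambda>x. \<Sum>i\<in>insert i B. f i x)"
    using insert.hyps by simp
  then show ?case ..
qed

lemma bounded_linear_lipschitz_on_compose:
  assumes "bounded_linear T" "L-lipschitz_on U f"
  shows "\<exists>M. M-lipschitz_on U (\<lambda>x. T (f x))"
proof -
  obtain B where "B-lipschitz_on (f ` U) T"
    using bounded_linear.lipschitz_boundE[OF assms(1)] .
  from lipschitz_on_compose2[OF assms(2) this] show ?thesis ..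
qed

lemma smooth_differentiable:
  assumes "smooth f"
  shows "f differentiable (at x)"
proof -
  have "of_class_C (Suc 0) f" using assms unfolding smooth_def by blast
  then show ?thesis by simp
qed

lemma smooth_lipschitz_grad:
  assumes "smooth f"
  shows "\<exists>L. L-lipschitz_on (cball 0 R) (grad f)"
proof -
  \<comment> \<open>Second order smoothness makes each directional derivative of class
    \<open>C^1\<close>, hence Lipschitz on balls.\<close>
  have "of_class_C (Suc 1) f" using assms unfolding smooth_def by blast
  then have C1: "of_class_C 1 (\<lambda>x. frechet_derivative f (at x) b)" for b
    by (simp only: of_class_C.simps)
  have "\<exists>L. L-lipschitz_on (cball 0 R) (\<lambda>x. frechet_derivative f (at x) b *\<^sub>R b)" for b
  proof -
    obtain L where L: "L-lipschitz_on (cball 0 R) (\<lambda>x. frechet_derivative f (at x) b)"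
      using of_class_C_1_lipschitz_on_cball[OF C1] by blast
    show ?thesis
      by (rule bounded_linear_lipschitz_on_compose[OF bounded_linear_scaleR_left L])
  qed
  then have "\<exists>L. L-lipschitz_on (cball 0 R)
      (\<lambda>x. \<Sum>b\<in>Basis. frechet_derivative f (at x) b *\<^sub>R b)"
    by (intro lipschitz_on_sum_exists) auto
  moreover have "grad f = (\<lambda>x. \<Sum>b\<in>Basis. frechet_derivative f (at x) b *\<^sub>R b)"
    using grad_eq_sum[OF smooth_differentiable[OF assms]] by (rule ext)
  ultimately show ?thesis by (simp only:)
qed

section \<open>Hamiltonian systems\<close>

lemma transpose_J_mat: "transpose J_mat = - J_mat"
  by (auto simp: vec_eq_iff transpose_def J_mat_def split: sum.split)

lemma J_mat_vector_mult:
  "J_mat *v x = (\<chi> i. case i of Inl a \<Rightarrow> x $ Inr a | Inr a \<Rightarrow> - x $ Inl a)"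
proof -
  have "(\<Sum>j\<in>UNIV. J_mat $ i $ j * x $ j)
      = (\<Sum>a\<in>UNIV. J_mat $ i $ Inl a * x $ Inl a) + (\<Sum>a\<in>UNIV. J_mat $ i $ Inr a * x $ Inr a)" for i
    by (simp add: UNIV_Plus_UNIV[symmetric] sum.Plus del: UNIV_Plus_UNIV)
  then show ?thesis
    by (auto simp: vec_eq_iff matrix_vector_mult_def J_mat_def if_distrib[of "\<lambda>c. c * _"] 
        sum.delta' cong: if_cong split: sum.split)
qed

lemma minus_matrix_vector_mult: "(- M) *v x = - (M *v (x :: real ^ 'n))"
  by (simp add: vec_eq_iff matrix_vector_mult_def sum_negf)

lemma transpose_J_mat_mult_J_mat: "transpose J_mat ** J_mat = mat 1"
  by (rule matrix_eq[THEN iffD2])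
     (auto simp: matrix_vector_mul_assoc[symmetric] transpose_J_mat minus_matrix_vector_mult
        J_mat_vector_mult vec_eq_iff split: sum.split)

text \<open>Moving \<open>J_mat\<close> to the other factor of the inner product changes its sign.
  For \<open>v = grad H x\<close> this is conservation of energy.\<close>

lemma J_mat_skew: "v \<bullet> (J_mat *v v) = 0"
proof -
  have "v \<bullet> (J_mat *v v) = (transpose J_mat *v v) \<bullet> v"
    by (simp add: dot_lmul_matrix[symmetric])
  also have "\<dots> = - (v \<bullet> (J_mat *v v))"
    by (simp add: transpose_J_mat minus_matrix_vector_mult inner_commute)
  finally show ?thesis by simp
qed

text \<open>Asking for a gradient that is Lipschitz on balls, in place of \<open>smooth\<close>,
  lets the reduced Hamiltonian be treated by the chain rule for its gradient alone.\<close>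

lemma hamiltonian_bounded_maximal_solution:
  fixes H :: "real ^ ('m::finite + 'm) \<Rightarrow> real"
  assumes diff: "\<And>v. H differentiable (at v)"
    and lip: "\<And>R. \<exists>L. L-lipschitz_on (cball 0 R) (grad H)"
    and S: "open S" "bounded S" "x0 \<in> S"
    and fr: "\<And>v. v \<in> frontier S \<Longrightarrow> H v \<noteq> H x0"
  shows "\<exists>x. maximal_solution (hamiltonian_field H) x0 UNIV x \<and> bounded (range x) \<and>
            (\<forall>I y. maximal_solution (hamiltonian_field H) x0 I y \<longrightarrow> I = UNIV \<and> y = x)"
proof (rule conserved_quantity_maximal_solution[where V = H, OF _ _ _ S fr])
  show "(H has_derivative (\<lambda>h. h \<bullet> grad H v)) (at v)" for v
    using GDERIV_grad[OF diff] by (simp add: gderiv_def)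
  show "hamiltonian_field H v \<bullet> grad H v = 0" for v
    by (simp add: hamiltonian_field_def inner_commute J_mat_skew)
  show "\<exists>L. L-lipschitz_on (cball 0 R) (hamiltonian_field H)" for R
  proof -
    obtain L where L: "L-lipschitz_on (cball 0 R) (grad H)" using lip by blast
    show ?thesis
      unfolding hamiltonian_field_def[abs_def]
      by (rule bounded_linear_lipschitz_on_compose[OF matrix_vector_mul_bounded_linear L])
  qed
qed

section \<open>Pulling the system back along the symplectic matrix\<close>

lemma symplectic_inverse_mult:
  assumes "transpose A ** J_mat ** A = J_mat"
  shows "symplectic_inverse A ** A = mat 1"
  using assms by (simp add: symplectic_inverse_def matrix_mul_assoc[symmetric] transpose_J_mat_mult_J_mat)

lemma GDERIV_compose_matrix:
  fixes A :: "real ^ 'k::finite ^ 'n::finite"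
  assumes "f differentiable (at (A *v z))"
  shows "GDERIV (\<lambda>z. f (A *v z)) z :> transpose A *v grad f (A *v z)"
proof -
  have "((\<lambda>z. f (A *v z)) has_derivative (\<lambda>h. (A *v h) \<bullet> grad f (A *v z))) (at z)"
    using has_derivative_compose[OF bounded_linear_imp_has_derivative
        [OF matrix_vector_mul_bounded_linear] GDERIV_grad[OF assms, unfolded gderiv_def]] .
  moreover have "(A *v h) \<bullet> w = h \<bullet> (transpose A *v w)" for h w
    by (metis dot_lmul_matrix inner_commute transpose_matrix_vector)
  ultimately show ?thesis by (simp add: gderiv_def)
qed

text \<open>This carries the boundary condition on \<open>S\<close> over to the reduced system. For
  an open set the frontier is the closure without the set, and the closure of a preimage lies in the
  preimage of the closure.\<close>

lemma frontier_vimage_subset: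
  assumes "continuous_on UNIV f" "open S"
  shows "f ` frontier (f -` S) \<subseteq> frontier S"
proof -
  have "closure (f -` S) \<subseteq> f -` closure S"
    using assms(1) closure_subset
    by (intro closure_minimal closed_vimage) auto
  moreover have "open (f -` S)" using assms by (rule open_vimage[rotated])
  ultimately show ?thesis using assms(2) by (auto simp: frontier_def interior_open)
qed

theorem theorem3p9:
  fixes H :: "real ^ ('n::finite + 'n) \<Rightarrow> real"
    and A :: "real ^ ('k::finite + 'k) ^ ('n + 'n)"
    and x0 :: "real ^ ('n + 'n)"
    and S :: "(real ^ ('n + 'n)) set"
  assumes "CARD('k) \<le> CARD('n)"
    and "smooth H"
    and "transpose A ** J_mat ** A = J_mat"
    and "x0 \<in> range (\<lambda>z. A *v z)"
    and "open S" and "bounded S" and "x0 \<in> S"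
    and "(\<forall>x\<in>frontier S. H x0 < H x) \<or> (\<forall>x\<in>frontier S. H x0 > H x)"
  shows "(\<exists>x. maximal_solution (hamiltonian_field H) x0 UNIV x \<and> bounded (range x) \<and>
            (\<forall>I y. maximal_solution (hamiltonian_field H) x0 I y \<longrightarrow> I = UNIV \<and> y = x))
       \<and> (\<exists>z. maximal_solution (hamiltonian_field (\<lambda>z. H (A *v z)))
                (symplectic_inverse A *v x0) UNIV z \<and> bounded (range z) \<and>
            (\<forall>I w. maximal_solution (hamiltonian_field (\<lambda>z. H (A *v z)))
                (symplectic_inverse A *v x0) I w \<longrightarrow> I = UNIV \<and> w = z))"
proof (rule conjI; rule hamiltonian_bounded_maximal_solution)
  let ?K = "\<lambda>z. H (A *v z)" and ?S = "(*v) A -` S"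
  \<comment> \<open>Either strict inequality excludes the value \<open>H x0\<close> on the
    frontier.\<close>
  have fr: "H v \<noteq> H x0" if "v \<in> frontier S" for v
    using assms(8) that by fastforce
  then show "H v \<noteq> H x0" if "v \<in> frontier S" for v using that .
  show "H differentiable (at v)" for v
    using assms(2) by (rule smooth_differentiable)
  show "\<exists>L. L-lipschitz_on (cball 0 R) (grad H)" for R
    using assms(2) by (rule smooth_lipschitz_grad)
  show "open S" "bounded S" "x0 \<in> S" by fact+
  have cont: "continuous_on UNIV ((*v) A)"
    by (intro linear_continuous_on matrix_vector_mul_bounded_linear)
  have left_inverse: "symplectic_inverse A *v (A *v z) = z" for z
    by (simp add: matrix_vector_mul_assoc symplectic_inverse_mult[OF assms(3)])
  \<comment> \<open>Writing \<open>x0 = A *v z\<close>, the left inverse recovers \<open>z\<close>,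
    and \<open>A\<close> maps it back to \<open>x0\<close>.\<close>
  then have x0: "A *v (symplectic_inverse A *v x0) = x0"
    using assms(4) by auto
  have grad_K: "GDERIV ?K z :> transpose A *v grad H (A *v z)" for z
    by (rule GDERIV_compose_matrix[OF smooth_differentiable[OF assms(2)]])
  show "?K differentiable (at z)" for z
    using grad_K unfolding gderiv_def differentiable_def by blast
  show "\<exists>L. L-lipschitz_on (cball 0 R) (grad ?K)" for R
  proof -
    obtain B where B: "B-lipschitz_on (cball 0 R) ((*v) A)"
      using bounded_linear.lipschitz_boundE[OF matrix_vector_mul_bounded_linear] .
    have "bounded ((*v) A ` cball 0 R)"
      by (intro compact_imp_bounded compact_continuous_image continuous_on_subset[OF cont]) auto
    \<comment> \<open>The gradient of the reduced Hamiltonian is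
      \<open>transpose A *v grad H (A *v z)\<close>. Since \<open>A\<close> maps the ball into a
      ball of radius \<open>Q\<close>, the Lipschitz constant of \<open>grad H\<close> there can be
      used.\<close>
    then obtain Q where "(*v) A ` cball 0 R \<subseteq> cball 0 Q"
      by (metis bounded_iff mem_cball_0 subsetI)
    moreover obtain L where "L-lipschitz_on (cball 0 Q) (grad H)"
      using smooth_lipschitz_grad[OF assms(2)] by blast
    ultimately have "(L * B)-lipschitz_on (cball 0 R) (\<lambda>z. grad H (A *v z))"
      using lipschitz_on_compose2[OF B] lipschitz_on_subset by blast
    moreover have "grad ?K = (\<lambda>z. transpose A *v grad H (A *v z))"
      using grad_eqI[OF grad_K] by (rule ext)
    ultimately show ?thesis
      using bounded_linear_lipschitz_on_compose[OF matrix_vector_mul_bounded_linear] by metis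
  qed
  show "open ?S"
    using \<open>open S\<close> cont by (rule open_vimage)
  \<comment> \<open>A point \<open>z\<close> of the preimage equals
    \<open>symplectic_inverse A *v (A *v z)\<close> with \<open>A *v z\<close> in \<open>S\<close>,
    so the preimage lies in a linear image of a bounded set.\<close>
  have "?S \<subseteq> (*v) (symplectic_inverse A) ` S"
    using left_inverse by (metis image_eqI subsetI vimage_eq)
  then show "bounded ?S"
    by (rule bounded_subset[OF bounded_linear_image[OF \<open>bounded S\<close> matrix_vector_mul_bounded_linear]])
  show "symplectic_inverse A *v x0 \<in> ?S"
    using x0 \<open>x0 \<in> S\<close> by simp
  show "?K z \<noteq> ?K (symplectic_inverse A *v x0)" if "z \<in> frontier ?S" for z
    using frontier_vimage_subset[OF cont \<open>open S\<close>] that fr x0 by auto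
qed

end
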